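(* Fix a rational $\epsilon$ with $0<\epsilon<1$. For all rational $\delta \in (0,1)$, $$\mathrm{SC}(\delta) \leq_{\mathrm{w}} \mathrm{LUA}\bigl(\lambda n.\, (\log_2 n)^{1-\epsilon}\bigr).$$
   Context: Prefix-free complexity: a prefix-free machine is a partial recursive $M$ from $\{0,1\}^*$ to $\{0,1\}^*$ with prefix-free domain; $U$ is universal if for each prefix-free machine $M$ there is $\rho$ with $U(\rho^\frown\tau)\simeq M(\tau)$ for all $\tau$. Fix a universal $U$ and let $K(\sigma)=\min\{|\tau| : U(\tau)=\sigma\}$. For $\delta\in(0,1)$, $\mathrm{SC}(\delta)$ is the set of $\delta$-shift complex sequences: those $X\in\{0,1\}^{\mathbb{N}}$ for which there is $c\in\mathbb{N}$ with $K(\tau)\geq\delta|\tau|-c$ for every (contiguous, finite) substring $\tau$ of $X$. A partial recursive $\psi\colon\subseteq\mathbb{N}\to\mathbb{N}$ is linearly universal if for every partial recursive $\theta\colon\subseteq\mathbb{N}\to\mathbb{N}$ there are $a,b\in\mathbb{N}$ with $\psi(ax+b)\simeq\theta(x)$ for all $x$. For $p\colon\mathbb{N}\to(1,\infty)$, $\mathrm{LUA}(p)$ is the set of $X\in\mathbb{N}^{\mathbb{N}}$ such that $X(n)<p(n)$ for all $n$ and, for some linearly universal partial recursive $\psi$, there is no $n\in\operatorname{dom}\psi$ with $X(n)=\psi(n)$. Convention: if $p$ is only a partial function into $\mathbb{R}$, but its restriction to $\{n\ge a\}$ is total, computable, nondecreasing, unbounded with values in $(1,\infty)$ for some $a$,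 then $\mathrm{LUA}(p)$ means $\mathrm{LUA}(\tilde p)$ where $\tilde p(n)=p(n)$ for $n\geq a$ and $\tilde p(n)=p(a)$ for $n<a$ (different $a$ give weakly equivalent classes). For $P,Q\subseteq\mathbb{N}^{\mathbb{N}}$, $P\leq_{\mathrm{w}}Q$ means every $Y\in Q$ Turing-computes some $X\in P$. *)

theory Defs
  imports
    Complex_Main
    "HOL-Library.Nat_Bijection"
    "HOL-Library.Sublist"
begin

section \<open>Partial recursive functions and Turing reducibility\<close>

text \<open>
  Kleene's partial recursive functions, as partial functions on \<open>nat\<close>; tuples of arguments are
  coded by the Cantor pairing function \<open>prod_encode\<close>. The parameter \<open>A\<close> is a set of total
  functions that are available as oracles.
\<close>

primrec prim_iter :: "nat option \<Rightarrow> (nat \<Rightarrow> nat \<Rightarrow> nat option) \<Rightarrow> nat \<Rightarrow> nat option" where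
  "prim_iter s h 0 = s"
| "prim_iter s h (Suc k) = Option.bind (prim_iter s h k) (h k)"

text \<open>Unbounded search diverges if it meets an undefined value before the first zero.\<close>

definition mu_search :: "(nat \<rightharpoonup> nat) \<Rightarrow> nat option" where
  "mu_search h =
    (if \<exists>k. h k = Some 0 \<and> {..<k} \<subseteq> dom h then Some (LEAST k. h k = Some 0) else None)"

inductive partrec_in :: "(nat \<Rightarrow> nat) set \<Rightarrow> (nat \<rightharpoonup> nat) \<Rightarrow> bool" for A where
  zero: "partrec_in A (\<lambda>n. Some 0)"
| succ: "partrec_in A (\<lambda>n. Some (Suc n))"
| left: "partrec_in A (\<lambda>n. Some (fst (prod_decode n)))"
| right: "partrec_in A (\<lambda>n. Some (snd (prod_decode n)))"
| query: "g \<in> A \<Longrightarrow> partrec_in A (\<lambda>n. Some (g n))"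
| pair: "partrec_in A f \<Longrightarrow> partrec_in A g \<Longrightarrow>
    partrec_in A (\<lambda>n. Option.bind (f n) (\<lambda>x. Option.bind (g n) (\<lambda>y. Some (prod_encode (x, y)))))"
| comp: "partrec_in A f \<Longrightarrow> partrec_in A g \<Longrightarrow> partrec_in A (\<lambda>n. Option.bind (g n) f)"
| prec: "partrec_in A f \<Longrightarrow> partrec_in A g \<Longrightarrow>
    partrec_in A (\<lambda>n. case prod_decode n of (a, k) \<Rightarrow>
      prim_iter (f a) (\<lambda>i v. g (prod_encode (a, prod_encode (i, v)))) k)"
| mu: "partrec_in A f \<Longrightarrow> partrec_in A (\<lambda>a. mu_search (\<lambda>k. f (prod_encode (a, k))))"

abbreviation partrec :: "(nat \<rightharpoonup> nat) \<Rightarrow> bool" where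
  "partrec \<equiv> partrec_in {}"

definition turing_computes :: "(nat \<Rightarrow> nat) \<Rightarrow> (nat \<Rightarrow> nat) \<Rightarrow> bool" where
  "turing_computes Y X \<longleftrightarrow> partrec_in {Y} (\<lambda>n. Some (X n))"

definition weakly_reducible :: "(nat \<Rightarrow> nat) set \<Rightarrow> (nat \<Rightarrow> nat) set \<Rightarrow> bool"
    (infix "\<le>\<^sub>w" 50) where
  "P \<le>\<^sub>w Q \<longleftrightarrow> (\<forall>Y\<in>Q. \<exists>X\<in>P. turing_computes Y X)"

section \<open>Prefix-free complexity and shift complexity\<close>

definition string_code :: "bool list \<Rightarrow> nat" where
  "string_code \<sigma> = list_encode (map of_bool \<sigma>)"

definition partrec_strings :: "(bool list \<rightharpoonup> bool list) \<Rightarrow> bool" where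
  "partrec_strings M \<longleftrightarrow>
    (\<exists>f. partrec f \<and> (\<forall>\<sigma>. f (string_code \<sigma>) = map_option string_code (M \<sigma>)))"

definition prefix_free_machine :: "(bool list \<rightharpoonup> bool list) \<Rightarrow> bool" where
  "prefix_free_machine M \<longleftrightarrow>
    partrec_strings M \<and> (\<forall>\<sigma>\<in>dom M. \<forall>\<tau>\<in>dom M. prefix \<sigma> \<tau> \<longrightarrow> \<sigma> = \<tau>)"

definition universal_machine :: "(bool list \<rightharpoonup> bool list) \<Rightarrow> bool" where
  "universal_machine U \<longleftrightarrow> prefix_free_machine U \<and>
    (\<forall>M. prefix_free_machine M \<longrightarrow> (\<exists>\<rho>. \<forall>\<tau>. U (\<rho> @ \<tau>) = M \<tau>))"

definition prefix_complexity :: "(bool list \<rightharpoonup> bool list) \<Rightarrow> bool list \<Rightarrow> nat" where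
  "prefix_complexity U \<sigma> = (LEAST n. \<exists>\<tau>. U \<tau> = Some \<sigma> \<and> length \<tau> = n)"

text \<open>
  A binary sequence \<open>B\<close> is viewed as the element \<open>\<lambda>n. of_bool (B n)\<close> of Baire space; its finite
  contiguous substrings are the lists \<open>map B [i..<j]\<close>.
\<close>

definition SC :: "(bool list \<rightharpoonup> bool list) \<Rightarrow> real \<Rightarrow> (nat \<Rightarrow> nat) set" where
  "SC U \<delta> = {(\<lambda>n. of_bool (B n)) | B :: nat \<Rightarrow> bool.
    \<exists>c::nat. \<forall>i j. let \<tau> = map B [i..<j] in
      real (prefix_complexity U \<tau>) \<ge> \<delta> * real (length \<tau>) - real c}"

section \<open>Linearly universal avoidance\<close>

definition linearly_universal :: "(nat \<rightharpoonup> nat) \<Rightarrow> bool" where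
  "linearly_universal \<psi> \<longleftrightarrow> partrec \<psi> \<and>
    (\<forall>\<theta>. partrec \<theta> \<longrightarrow> (\<exists>a b. \<forall>x. \<psi> (a * x + b) = \<theta> x))"

definition LUA :: "(nat \<Rightarrow> real) \<Rightarrow> (nat \<Rightarrow> nat) set" where
  "LUA p = {X. (\<forall>n. real (X n) < p n) \<and>
    (\<exists>\<psi>. linearly_universal \<psi> \<and> \<not> (\<exists>n\<in>dom \<psi>. \<psi> n = Some (X n)))}"

text \<open>
  For a bound \<open>p\<close> that is only meaningful from some \<open>a\<close> on, \<open>LUA p\<close> stands for
  \<open>LUA (constant_below a p)\<close>.
\<close>

definition constant_below :: "nat \<Rightarrow> (nat \<Rightarrow> real) \<Rightarrow> nat \<Rightarrow> real" where
  "constant_below a p n = (if n < a then p a else p n)"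

text \<open>
  For \<open>p n = (log 2 n) powr (1 - \<epsilon>)\<close> the admissible \<open>a\<close> are exactly those with \<open>a \<ge> 3\<close>, since
  \<open>p 2 = 1\<close>; the values of \<open>p\<close> at \<open>0\<close> and \<open>1\<close> are never used.
\<close>

lemma log_bound_gt_1:
  assumes "\<epsilon> < 1" and "n \<ge> (3::nat)"
  shows "(log 2 (real n)) powr (1 - \<epsilon>) > 1"
proof -
  have "log 2 (real n) > 1" using assms(2) by simp
  then show ?thesis using assms(1) by simp
qed

lemma log_bound_mono:
  assumes "\<epsilon> < 1" and "3 \<le> m" and "m \<le> (n::nat)"
  shows "(log 2 (real m)) powr (1 - \<epsilon>) \<le> (log 2 (real n)) powr (1 - \<epsilon>)"
  using assms by (intro powr_mono2) auto

end

theory Submission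
  imports Defs
begin

text \<open>
  Let \<open>X\<close> avoid a linearly universal \<open>\<psi>\<close>. For a program \<open>\<rho>\<close> and a tuple \<open>T\<close> of \<open>a\<close> strings of
  length \<open>l\<close>, the position of \<open>U(\<rho>)\<close> in \<open>T\<close> is a partial recursive function of \<open>(l, \<rho>, T)\<close>, so \<open>X\<close>
  names a position of \<open>T\<close> at which \<open>U(\<rho>)\<close> does not stand. The strings that are never ruled out in this
  way include \<open>U(\<rho>)\<close>, and there are fewer than \<open>a\<close> of them, because \<open>a\<close> of them would form a tuple.
  This needs \<open>X < a\<close> on all questions; their codes have \<open>O(l a)\<close> bits, and
  \<open>(l a) powr (1 - \<epsilon>) \<le> a\<close> holds when \<open>a\<close> is a large power of \<open>l\<close>. Collecting the candidates of
  all programs of length below \<open>\<delta> l\<close>, \<open>X\<close> computes a set that contains every string of length \<open>l\<close>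
  and complexity below \<open>\<delta> l\<close> and has at most \<open>\<lambda> ^ l\<close> members of length \<open>l\<close>, for some \<open>\<lambda> < 2\<close>.
  A sequence avoiding such a set of factors is found bit by bit by keeping a potential function small.
\<close>

section \<open>Closure properties of computable functions\<close>

definition computable_in :: "(nat \<Rightarrow> nat) set \<Rightarrow> (nat \<Rightarrow> nat) \<Rightarrow> bool" where
  "computable_in A f \<longleftrightarrow> partrec_in A (\<lambda>n. Some (f n))"

abbreviation decidable_in :: "(nat \<Rightarrow> nat) set \<Rightarrow> (nat \<Rightarrow> bool) \<Rightarrow> bool" where
  "decidable_in A P \<equiv> computable_in A (\<lambda>n. of_bool (P n))"

abbreviation (input) pfst :: "nat \<Rightarrow> nat" where "pfst n \<equiv> fst (prod_decode n)"
abbreviation (input) psnd :: "nat \<Rightarrow> nat" where "psnd n \<equiv> snd (prod_decode n)"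

named_theorems computable

lemma computable_comp:
  assumes "computable_in A f" "computable_in A g"
  shows "computable_in A (\<lambda>n. f (g n))"
  using partrec_in.comp[OF assms[unfolded computable_in_def]] by (simp add: computable_in_def)

lemma computable_pair [computable]:
  assumes "computable_in A f" "computable_in A g"
  shows "computable_in A (\<lambda>n. prod_encode (f n, g n))"
  using partrec_in.pair[OF assms[unfolded computable_in_def]] by (simp add: computable_in_def)

lemma computable_pfst [computable]:
  "computable_in A f \<Longrightarrow> computable_in A (\<lambda>n. pfst (f n))"
  by (rule computable_comp[where f = pfst]) (simp_all add: computable_in_def partrec_in.left)

lemma computable_psnd [computable]:
  "computable_in A f \<Longrightarrow> computable_in A (\<lambda>n. psnd (f n))"
  by (rule computable_comp[where f = psnd]) (simp_all add: computable_in_def partrec_in.right)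

lemma computable_Suc [computable]:
  "computable_in A f \<Longrightarrow> computable_in A (\<lambda>n. Suc (f n))"
  by (rule computable_comp[where f = Suc]) (simp_all add: computable_in_def partrec_in.succ)

text \<open>\<open>partrec_in\<close> has no identity constructor; pairing the two projections
  supplies one.\<close>

lemma computable_id [computable]: "computable_in A (\<lambda>n. n)"
proof -
  have "computable_in A (\<lambda>n. prod_encode (pfst n, psnd n))"
    by (intro computable_pair) (simp_all add: computable_in_def partrec_in.left partrec_in.right)
  then show ?thesis by simp
qed

lemma computable_const [computable]: "computable_in A (\<lambda>n. c)"
proof (induction c)
  case 0
  show ?case by (simp add: computable_in_def partrec_in.zero)
next
  case (Suc c)
  then show ?case by (rule computable_Suc)
qed

lemma computable_query:
  "g \<in> A \<Longrightarrow> computable_in A f \<Longrightarrow> computable_in A (\<lambda>n. g (f n))"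
  by (rule computable_comp[where f = g]) (simp_all add: computable_in_def partrec_in.query)

lemma prim_iter_total: "prim_iter (Some s) (\<lambda>i v. Some (h i v)) k = Some (rec_nat s h k)"
  by (induction k) simp_all

text \<open>The step function is uncurried so that it may depend on the input \<open>n\<close>,
  which is carried along as the parameter of \<open>prec\<close>.\<close>

lemma computable_rec_nat [computable]:
  assumes s: "computable_in A s"
    and h: "computable_in A (\<lambda>m. h (pfst m) (pfst (psnd m)) (psnd (psnd m)))"
    and k: "computable_in A k"
  shows "computable_in A (\<lambda>n. rec_nat (s n) (h n) (k n))"
proof -
  have "computable_in A (\<lambda>m. rec_nat (s (pfst m)) (h (pfst m)) (psnd m))"
    using partrec_in.prec[OF s[unfolded computable_in_def] h[unfolded computable_in_def]]
    by (simp add: computable_in_def prim_iter_total case_prod_beta)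
  from computable_comp[OF this computable_pair[OF computable_id k]] show ?thesis by simp
qed

lemma computable_add [computable]:
  assumes "computable_in A f" "computable_in A g"
  shows "computable_in A (\<lambda>n. f n + g n)"
proof -
  have eq: "rec_nat x (\<lambda>_ v. Suc v) k = x + k" for x k by (induction k) simp_all
  have "computable_in A (\<lambda>n. rec_nat (f n) (\<lambda>_ v. Suc v) (g n))"
    by (intro computable assms)
  then show ?thesis by (simp add: eq)
qed

lemma computable_diff [computable]:
  assumes "computable_in A f" "computable_in A g"
  shows "computable_in A (\<lambda>n. f n - g n)"
proof -
  have pred: "rec_nat 0 (\<lambda>i _. i) k = k - 1" for k by (cases k) simp_all
  have "computable_in A (\<lambda>n. rec_nat 0 (\<lambda>i _. i) (h n))" if "computable_in A h" for h
    by (intro computable that)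
  then have p: "computable_in A (\<lambda>n. h n - 1)" if "computable_in A h" for h
    using that by (simp add: pred)
  have eq: "rec_nat x (\<lambda>_ v. v - 1) k = x - k" for x k :: nat by (induction k) simp_all
  have "computable_in A (\<lambda>n. rec_nat (f n) (\<lambda>_ v. v - 1) (g n))"
    by (intro computable assms p)
  then show ?thesis by (simp only: eq)
qed

lemma computable_sum [computable]:
  assumes "computable_in A (\<lambda>m. F (pfst m) (psnd m))" "computable_in A b"
  shows "computable_in A (\<lambda>n. \<Sum>k<b n. F n k)"
proof -
  have eq: "rec_nat 0 (\<lambda>i v. v + G i) k = (\<Sum>i<k. G i)" for G :: "nat \<Rightarrow> nat" and k
    by (induction k) simp_all
  have "computable_in A (\<lambda>m. F (pfst m) (pfst (psnd m)))"
    using computable_comp[OF assms(1), of "\<lambda>m. prod_encode (pfst m, pfst (psnd m))"]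
    by (simp add: computable)
  then have "computable_in A (\<lambda>n. rec_nat 0 (\<lambda>i v. v + F n i) (b n))"
    by (intro computable assms(2))
  then show ?thesis by (simp only: eq)
qed

lemma computable_mult [computable]:
  assumes "computable_in A f" "computable_in A g"
  shows "computable_in A (\<lambda>n. f n * g n)"
proof -
  have "computable_in A (\<lambda>n. \<Sum>k<g n. f n)"
    by (intro computable computable_comp[OF assms(1)] assms(2))
  then show ?thesis by (simp add: mult.commute)
qed

lemma computable_power [computable]:
  assumes "computable_in A f" "computable_in A g"
  shows "computable_in A (\<lambda>n. f n ^ g n)"
proof -
  have eq: "rec_nat 1 (\<lambda>_ v. v * x) k = x ^ k" for x k :: nat by (induction k) simp_all
  have "computable_in A (\<lambda>n. rec_nat 1 (\<lambda>_ v. v * f n) (g n))"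
    by (intro computable computable_comp[OF assms(1)] assms(2))
  then show ?thesis by (simp only: eq)
qed

lemma decidable_not [computable]:
  assumes "decidable_in A P" shows "decidable_in A (\<lambda>n. \<not> P n)"
proof -
  have eq: "1 - of_bool b = (of_bool (\<not> b) :: nat)" for b by simp
  have "computable_in A (\<lambda>n. 1 - of_bool (P n))" by (intro computable assms)
  then show ?thesis by (simp only: eq)
qed

lemma decidable_conj [computable]:
  assumes "decidable_in A P" "decidable_in A Q" shows "decidable_in A (\<lambda>n. P n \<and> Q n)"
proof -
  have "computable_in A (\<lambda>n. of_bool (P n) * of_bool (Q n))" by (intro computable assms)
  then show ?thesis by (simp add: of_bool_conj)
qed

lemma decidable_le [computable]:
  assumes "computable_in A f" "computable_in A g" shows "decidable_in A (\<lambda>n. f n \<le> g n)"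
proof -
  have eq: "1 - (x - y) = of_bool (x \<le> y)" for x y :: nat by simp
  have "computable_in A (\<lambda>n. 1 - (f n - g n))" by (intro computable assms)
  then show ?thesis by (simp only: eq)
qed

lemma decidable_less [computable]:
  assumes "computable_in A f" "computable_in A g" shows "decidable_in A (\<lambda>n. f n < g n)"
proof -
  have "decidable_in A (\<lambda>n. Suc (f n) \<le> g n)" by (intro computable assms)
  then show ?thesis by (simp only: Suc_le_eq)
qed

lemma decidable_eq [computable]:
  assumes "computable_in A f" "computable_in A g" shows "decidable_in A (\<lambda>n. f n = g n)"
proof -
  have "decidable_in A (\<lambda>n. f n \<le> g n \<and> g n \<le> f n)" by (intro computable assms)
  then show ?thesis by (simp only: order_eq_iff[symmetric])
qed

lemma decidable_ex_less [computable]: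
  assumes "decidable_in A (\<lambda>m. P (pfst m) (psnd m))" "computable_in A b"
  shows "decidable_in A (\<lambda>n. \<exists>k<b n. P n k)"
proof -
  have eq: "0 < (\<Sum>k<x. of_bool (R k) :: nat) \<longleftrightarrow> (\<exists>k<x. R k)" for x :: nat and R
    by (induction x) (auto simp: less_Suc_eq)
  have "decidable_in A (\<lambda>n. 0 < (\<Sum>k<b n. of_bool (P n k) :: nat))"
    by (intro computable assms)
  then show ?thesis by (simp only: eq)
qed

lemma decidable_all_less [computable]:
  assumes "decidable_in A (\<lambda>m. P (pfst m) (psnd m))" "computable_in A b"
  shows "decidable_in A (\<lambda>n. \<forall>k<b n. P n k)"
proof -
  have "decidable_in A (\<lambda>n. \<not> (\<exists>k<b n. \<not> P n k))" by (intro computable assms)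
  then show ?thesis by simp
qed

lemma computable_if [computable]:
  assumes "decidable_in A P" "computable_in A f" "computable_in A g"
  shows "computable_in A (\<lambda>n. if P n then f n else g n)"
proof -
  have eq: "of_bool b * x + of_bool (\<not> b) * y = (if b then x else y)" for b and x y :: nat by simp
  have "computable_in A (\<lambda>n. of_bool (P n) * f n + of_bool (\<not> P n) * g n)"
    by (intro computable assms)
  then show ?thesis by (simp only: eq)
qed

text \<open>The quotient counts the \<open>k\<close> with \<open>Suc k * y \<le> x\<close>; the
  guard \<open>0 < y\<close> produces the default value 0 of division by zero.\<close>

lemma computable_div [computable]:
  assumes "computable_in A f" "computable_in A g"
  shows "computable_in A (\<lambda>n. f n div g n)"
proof -
  have eq: "(\<Sum>k<x. of_bool (0 < y \<and> Suc k * y \<le> x)) = x div y" for x y :: nat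
  proof (cases "y = 0")
    case False
    then have "k < x \<and> Suc k * y \<le> x \<longleftrightarrow> k < x div y" for k
      by (metis Suc_leI div_le_dividend lessI less_eq_div_iff_mult_less_eq less_le_trans neq0_conv)
    then have "{..<x} \<inter> {k. 0 < y \<and> Suc k * y \<le> x} = {..<x div y}"
      using False by (auto simp del: mult_Suc)
    then show ?thesis
      using sum_of_bool_eq[of "{..<x}" "\<lambda>k. 0 < y \<and> Suc k * y \<le> x", where ?'a = nat]
      by (simp only: finite_lessThan card_lessThan of_nat_id)
  qed simp
  have "computable_in A (\<lambda>n. \<Sum>k<f n. of_bool (0 < g n \<and> Suc k * g n \<le> f n))"
    by (intro computable computable_comp[OF assms(1)] computable_comp[OF assms(2)] assms)
  then show ?thesis by (simp only: eq)
qed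

lemma computable_mod [computable]:
  assumes "computable_in A f" "computable_in A g"
  shows "computable_in A (\<lambda>n. f n mod g n)"
proof -
  have "computable_in A (\<lambda>n. f n - f n div g n * g n)"
    by (intro computable_diff computable_mult computable_div assms)
  then show ?thesis by (simp only: minus_div_mult_eq_mod)
qed

section \<open>Avoiding a sparse decidable set of factors\<close>

text \<open>
  A string of length \<open>l\<close> is represented by a number below \<open>2 ^ l\<close>, first bit least significant, and
  \<open>S l w\<close> says that \<open>w\<close>, read as a string of length \<open>l\<close>, is forbidden. Thus \<open>ext_count\<close> counts the
  forbidden strings that extend the string \<open>u\<close> of length \<open>m\<close> by \<open>r\<close> bits.
\<close>

definition ext_count :: "(nat \<Rightarrow> nat \<Rightarrow> bool) \<Rightarrow> nat \<Rightarrow> nat \<Rightarrow> nat \<Rightarrow> nat" where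
  "ext_count S m r u = (\<Sum>v<2^r. of_bool (S (m + r) (u + 2^m * v)))"

text \<open>
  J. S. Miller's potential of the prefix \<open>s\<close> of length \<open>n\<close>: every forbidden string that starts with
  a nonempty suffix of \<open>s\<close> and still misses \<open>r\<close> bits has weight \<open>c ^ r\<close> for \<open>c = (N + 1) / (2 N)\<close>.
  Only \<open>r < Q * Suc n\<close> is counted, which makes the sum finite, and everything is scaled by
  \<open>(2 * N) ^ (Q * Suc n)\<close> to stay within the natural numbers.
\<close>

definition potential :: "(nat \<Rightarrow> nat \<Rightarrow> bool) \<Rightarrow> nat \<Rightarrow> nat \<Rightarrow> nat \<Rightarrow> nat \<Rightarrow> nat" where
  "potential S N Q n s = (\<Sum>m<n. \<Sum>r<Q * Suc n.
     Suc N ^ r * (2 * N) ^ (Q * Suc n - r) * ext_count S (Suc m) r (s div 2 ^ (n - Suc m)))"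

text \<open>Greedy choice: the next bit is 0 if this keeps the unscaled potential at most 1/2, and 1
  otherwise. Comparing scaled natural numbers makes the choice computable.\<close>

definition avoiding_prefix :: "(nat \<Rightarrow> nat \<Rightarrow> bool) \<Rightarrow> nat \<Rightarrow> nat \<Rightarrow> nat \<Rightarrow> nat" where
  "avoiding_prefix S N Q n = rec_nat 0 (\<lambda>n s.
     if 2 * potential S N Q (Suc n) s \<le> (2 * N) ^ (Q * Suc (Suc n)) then s else s + 2 ^ n) n"

lemma computable_avoiding_prefix:
  assumes S: "decidable_in A (\<lambda>x. S (pfst x) (psnd x))"
  shows "computable_in A (avoiding_prefix S N Q)"
proof -
  have S': "decidable_in A (\<lambda>x. S (l x) (w x))" if "computable_in A l" "computable_in A w" for l w
    using computable_comp[OF S computable_pair[OF that]] by simp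
  show ?thesis
    unfolding avoiding_prefix_def potential_def ext_count_def
    by (intro computable S')
qed

text \<open>The lowest bit of \<open>v\<close> is the next bit of the string, so the sum splits by
  the parity of \<open>v\<close>.\<close>

lemma ext_count_Suc: "ext_count S m (Suc r) u = ext_count S (Suc m) r u + ext_count S (Suc m) r (u + 2 ^ m)"
proof -
  have "(\<Sum>v<2 * n. f v) = (\<Sum>v<n. f (2 * v)) + (\<Sum>v<n. f (Suc (2 * v)))" for f :: "nat \<Rightarrow> nat" and n
    by (induction n) auto
  from this[of _ "2 ^ r"] show ?thesis
    by (simp add: ext_count_def algebra_simps)
qed

lemma ext_count_le_card:
  assumes "u < 2 ^ m"
  shows "ext_count S m r u \<le> card {w. w < 2 ^ (m + r) \<and> S (m + r) w}"
proof -
  have "ext_count S m r u = card {v \<in> {..<2^r}. S (m + r) (u + 2^m * v)}"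
    by (simp add: ext_count_def of_bool_def sum.If_cases Int_def)
  also have "\<dots> = card ((\<lambda>v. u + 2^m * v) ` {v \<in> {..<2^r}. S (m + r) (u + 2^m * v)})"
    by (subst card_image) (auto simp: inj_on_def)
  also have "\<dots> \<le> card {w. w < 2 ^ (m + r) \<and> S (m + r) w}"
  proof (intro card_mono image_subsetI)
    fix v assume v: "v \<in> {v \<in> {..<2^r}. S (m + r) (u + 2^m * v)}"
    have "u + 2^m * v < 2^m * Suc v" using assms by simp
    also have "\<dots> \<le> 2^m * 2^r" using v by (intro mult_left_mono) auto
    finally show "u + 2^m * v \<in> {w. w < 2 ^ (m + r) \<and> S (m + r) w}"
      using v by (simp add: power_add)
  qed auto
  finally show ?thesis .
qed

lemma geometric_sum_le:
  fixes x :: real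
  assumes "0 \<le> x" "x < 1"
  shows "(\<Sum>r\<in>{a..<b}. x ^ r) \<le> x ^ a / (1 - x)"
proof (cases "a \<le> b")
  case True
  then have "(\<Sum>r\<in>{a..<b}. x ^ r) * (1 - x) = x ^ a - x ^ b"
  proof (induction b rule: dec_induct)
    case (step n)
    then show ?case
      by (simp only: sum.atLeastLessThan_Suc distrib_right step.IH) (simp add: algebra_simps)
  qed simp
  then have "(\<Sum>r\<in>{a..<b}. x ^ r) = (x ^ a - x ^ b) / (1 - x)"
    using assms by (simp add: field_simps)
  also have "\<dots> \<le> x ^ a / (1 - x)"
    using assms by (intro divide_right_mono) auto
  finally show ?thesis .
qed (use assms in auto)

text \<open>Since \<open>2 * c\<close> exceeds 1 by \<open>1 / N\<close>, each step leaves room for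
  some new weight. In \<open>small\<close>, the first summand pays for strings starting at the new
  bit, the second for strings that the moving cutoff starts to count; \<open>x\<close> is the ratio
  of both geometric series.\<close>

context
  fixes S :: "nat \<Rightarrow> nat \<Rightarrow> bool" and N Q l0 :: nat and lam c x :: real
  assumes N: "N > 0" and lam: "1 \<le> lam" "lam \<le> 2"
    and sparse: "\<And>l. l \<ge> l0 \<Longrightarrow> card {w. w < 2 ^ l \<and> S l w} \<le> lam ^ l"
    and short: "\<And>l w. l < l0 \<Longrightarrow> \<not> S l w"
    and c_def: "c = real (Suc N) / real (2 * N)"
    and x_def: "x = c * lam" and x: "x < 1"
    and small: "x ^ l0 / (1 - x) + 4 * x ^ Q / (1 - x) \<le> 1 / (2 * N)" "4 * x ^ Q \<le> 1"
begin

definition real_potential :: "nat \<Rightarrow> nat \<Rightarrow> real" where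
  "real_potential n s = (\<Sum>m<n. \<Sum>r<Q * Suc n. c ^ r * ext_count S (Suc m) r (s div 2 ^ (n - Suc m)))"

lemma c_pos: "c > 0" using N by (simp add: c_def)
lemma c_eq: "2 * c = 1 + 1 / N" using N by (simp add: c_def field_simps)
lemma x_nonneg: "x \<ge> 0" using c_pos lam by (simp add: x_def)

lemma real_potential_eq: "real_potential n s = potential S N Q n s / (2 * N) ^ (Q * Suc n)"
proof -
  have "real (Suc N ^ r * (2 * N) ^ (R - r)) / (2 * N) ^ R = c ^ r" if "r < R" for r R
  proof -
    have "real (2 * N) ^ R = (2 * N) ^ r * (2 * N) ^ (R - r)"
      by (simp only: of_nat_power power_add[symmetric] le_add_diff_inverse[OF less_imp_le[OF that]])
    then show ?thesis using N by (simp add: c_def power_divide)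
  qed
  then show ?thesis
    unfolding real_potential_def potential_def of_nat_sum sum_divide_distrib
    by (intro sum.cong refl) (simp flip: times_divide_eq_left)
qed

lemma real_potential_le_half_iff: "2 * potential S N Q n s \<le> (2 * N) ^ (Q * Suc n) \<longleftrightarrow> real_potential n s \<le> 1 / 2"
proof -
  have "real_potential n s \<le> 1 / 2 \<longleftrightarrow> real (2 * potential S N Q n s) \<le> real ((2 * N) ^ (Q * Suc n))"
    unfolding real_potential_eq using N by (simp add: field_simps)
  then show ?thesis by (simp only: of_nat_le_iff)
qed

text \<open>Sparseness gives at most \<open>lam ^ (m + r)\<close> extensions, and each factor
  \<open>c * lam\<close> is an \<open>x\<close>; below length \<open>l0\<close> nothing is
  forbidden.\<close>

lemma ext_count_le:
  assumes "u < 2 ^ m"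
  shows "c ^ r * ext_count S m r u \<le> lam ^ m * x ^ r"
proof (cases "m + r \<ge> l0")
  case True
  have "real (ext_count S m r u) \<le> lam ^ (m + r)"
    using ext_count_le_card[OF assms, of S r] sparse[OF True] by linarith
  then have "c ^ r * ext_count S m r u \<le> c ^ r * lam ^ (m + r)"
    using c_pos by (intro mult_left_mono) auto
  then show ?thesis by (simp add: x_def power_add power_mult_distrib mult_ac)
next
  case False
  then have "ext_count S m r u = 0" using short by (simp add: ext_count_def)
  then show ?thesis using lam x_nonneg by simp
qed

text \<open>Averaging over the new bit: \<open>c\<close> times the sum of the two potentials is at
  most \<open>1 / 2 + 1 / (2 * N)\<close>, which equals \<open>c\<close>. So the sum is at most 1,
  and one of the two is at most 1/2.\<close>

lemma real_potential_step:
  assumes s: "s < 2 ^ n" and real_potential: "real_potential n s \<le> 1 / 2"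
  shows "real_potential (Suc n) s \<le> 1 / 2 \<or> real_potential (Suc n) (s + 2 ^ n) \<le> 1 / 2"
proof -
  define R R' where "R = Q * Suc n" and "R' = Q * Suc (Suc n)"
  define E where "E m r = c ^ r * ext_count S m r (s div 2 ^ (n - m))" for m r
  have R: "R \<le> Suc R'" by (simp add: R_def R'_def)
  have E_nonneg: "E m r \<ge> 0" for m r using c_pos by (simp add: E_def)
  have u: "s div 2 ^ (n - m) < 2 ^ m" if "m \<le> n" for m
    using s that by (simp add: less_mult_imp_div_less flip: power_add)
  have E_le: "E m r \<le> lam ^ m * x ^ r" if "m \<le> n" for m r
    unfolding E_def by (rule ext_count_le[OF u[OF that]])
  have shift: "(s + 2 ^ n) div 2 ^ (n - m) = s div 2 ^ (n - m) + 2 ^ m" if "m \<le> n" for m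
  proof -
    have "(2::nat) ^ n = 2 ^ m * 2 ^ (n - m)" using that by (simp flip: power_add)
    then show ?thesis by simp
  qed
  txt \<open>
    Revealing one bit divides the weights by \<open>c\<close> and splits the extensions between its two values.
    What enters anew is the forbidden strings that start with the new bit (\<open>m = 0\<close>) and those with
    a missing part that was so far too long to be counted (\<open>r \<ge> R\<close>).
  \<close>
  have "c * (real_potential (Suc n) s + real_potential (Suc n) (s + 2 ^ n)) = (\<Sum>m<Suc n. \<Sum>r<R'. E m (Suc r))"
    unfolding real_potential_def R'_def[symmetric] E_def ext_count_Suc sum.distrib[symmetric] sum_distrib_left
    by (intro sum.cong refl) (simp add: shift algebra_simps)
  \<comment> \<open>Reindexing by \<open>Suc r\<close>; the nonnegative terms with
    \<open>r = 0\<close> and \<open>0 < m\<close> are added to complete the old potential.\<close>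
  also have "\<dots> \<le> (\<Sum>m<Suc n. \<Sum>r<Suc R'. E m r * of_bool (0 < m \<or> 0 < r))"
    by (intro sum_mono, subst sum.lessThan_Suc_shift) (simp add: E_nonneg)
  also have "\<dots> = (\<Sum>r<Suc R'. E 0 r * of_bool (0 < r)) + (\<Sum>m<n. \<Sum>r<Suc R'. E (Suc m) r)"
    by (subst sum.lessThan_Suc_shift) simp
  also have "(\<Sum>r<Suc R'. E 0 r * of_bool (0 < r)) \<le> x ^ l0 / (1 - x)"
  proof -
    have "E 0 r \<le> of_bool (r \<ge> l0) * x ^ r" for r
      using E_le[of 0 r] short by (cases "r \<ge> l0") (auto simp: E_def ext_count_def)
    then have "E 0 r * of_bool (0 < r) \<le> of_bool (r \<ge> l0) * x ^ r" for r
      using E_nonneg[of 0 r] by (cases "0 < r") (auto intro: order_trans)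
    then have "(\<Sum>r<Suc R'. E 0 r * of_bool (0 < r)) \<le> (\<Sum>r<Suc R'. of_bool (r \<ge> l0) * x ^ r)"
      by (rule sum_mono)
    also have "\<dots> = (\<Sum>r\<in>{l0..<Suc R'}. x ^ r)"
      by (rule sum.mono_neutral_cong_right) auto
    also have "\<dots> \<le> x ^ l0 / (1 - x)" by (rule geometric_sum_le[OF x_nonneg x])
    finally show ?thesis .
  qed
  also have "(\<Sum>m<n. \<Sum>r<Suc R'. E (Suc m) r) =
      (\<Sum>m<n. \<Sum>r<R. E (Suc m) r) + (\<Sum>m<n. \<Sum>r\<in>{R..<Suc R'}. E (Suc m) r)"
    unfolding sum.distrib[symmetric] lessThan_atLeast0
    using R by (intro sum.cong refl sum.atLeastLessThan_concat[symmetric]) auto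
  also have "(\<Sum>m<n. \<Sum>r<R. E (Suc m) r) = real_potential n s"
    by (simp add: real_potential_def R_def E_def)
  \<comment> \<open>Crude estimates suffice because the cutoff grows with \<open>n\<close>:
    \<open>x ^ R\<close> contains \<open>x ^ Q\<close> to the power \<open>Suc n\<close>, which
    absorbs \<open>4 ^ Suc n\<close>.\<close>
  also have "(\<Sum>m<n. \<Sum>r\<in>{R..<Suc R'}. E (Suc m) r) \<le> 4 * x ^ Q / (1 - x)"
  proof -
    have "(\<Sum>r\<in>{R..<Suc R'}. E (Suc m) r) \<le> 2 ^ n * (x ^ R / (1 - x))" if "m < n" for m
    proof -
      have "lam ^ Suc m \<le> 2 ^ Suc m" using lam by (intro power_mono) auto
      also have "\<dots> \<le> 2 ^ n" using that by (intro power_increasing) auto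
      finally have "lam ^ Suc m \<le> 2 ^ n" .
      then have "E (Suc m) r \<le> 2 ^ n * x ^ r" for r
        using E_le[of "Suc m" r] that x_nonneg
        by (meson Suc_leI mult_right_mono order_trans zero_le_power)
      then have "(\<Sum>r\<in>{R..<Suc R'}. E (Suc m) r) \<le> 2 ^ n * (\<Sum>r\<in>{R..<Suc R'}. x ^ r)"
        unfolding sum_distrib_left by (rule sum_mono)
      also have "\<dots> \<le> 2 ^ n * (x ^ R / (1 - x))"
        by (intro mult_left_mono geometric_sum_le x_nonneg x) auto
      finally show ?thesis .
    qed
    then have "(\<Sum>m<n. \<Sum>r\<in>{R..<Suc R'}. E (Suc m) r) \<le> (\<Sum>m<n. 2 ^ n * (x ^ R / (1 - x)))"
      by (intro sum_mono) auto
    also have "\<dots> = n * 2 ^ n * x ^ R / (1 - x)" by simp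
    also have "\<dots> \<le> 4 ^ Suc n * x ^ R / (1 - x)"
    proof -
      have "n * 2 ^ n \<le> (2 ^ n * 2 ^ n :: nat)" by (intro mult_right_mono) (auto simp: less_imp_le)
      also have "\<dots> = 4 ^ n" by (simp flip: power_mult_distrib)
      also have "\<dots> \<le> 4 ^ Suc n" by simp
      finally have "real (n * 2 ^ n) \<le> real (4 ^ Suc n)" by (simp only: of_nat_le_iff)
      then show ?thesis using x x_nonneg by (intro divide_right_mono mult_right_mono) auto
    qed
    also have "4 ^ Suc n * x ^ R = (4 * x ^ Q) ^ Suc n"
      by (simp only: R_def power_mult power_mult_distrib)
    also have "(4 * x ^ Q) ^ Suc n / (1 - x) \<le> (4 * x ^ Q) ^ 1 / (1 - x)"
      using small x x_nonneg by (intro divide_right_mono power_decreasing) auto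
    finally show ?thesis by simp
  qed
  finally have "c * (real_potential (Suc n) s + real_potential (Suc n) (s + 2 ^ n)) \<le> 1 / 2 + 1 / (2 * N)"
    using real_potential small by linarith
  also have "\<dots> = c * 1" using c_eq by simp
  finally have "real_potential (Suc n) s + real_potential (Suc n) (s + 2 ^ n) \<le> 1"
    using c_pos by (simp only: mult_le_cancel_left_pos)
  then show ?thesis by linarith
qed

lemma avoiding_prefix_invariant:
  "avoiding_prefix S N Q n < 2 ^ n \<and> real_potential n (avoiding_prefix S N Q n) \<le> 1 / 2"
proof (induction n)
  case 0
  show ?case by (simp add: avoiding_prefix_def real_potential_def)
next
  case (Suc n)
  have "avoiding_prefix S N Q (Suc n) = (let s = avoiding_prefix S N Q n in
      if real_potential (Suc n) s \<le> 1 / 2 then s else s + 2 ^ n)"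
    by (simp only: real_potential_le_half_iff[symmetric] Let_def) (simp add: avoiding_prefix_def)
  then show ?case using Suc real_potential_step[of "avoiding_prefix S N Q n" n] by (auto simp: Let_def)
qed

text \<open>A forbidden suffix misses no bits and would alone contribute weight 1 to a potential of
  at most 1/2. Positivity of \<open>Q\<close> puts \<open>r = 0\<close> into the counted
  range.\<close>

lemma avoiding_prefix_avoids:
  assumes "m \<le> n" "0 < m" "0 < Q"
  shows "\<not> S m (avoiding_prefix S N Q n div 2 ^ (n - m))"
proof
  let ?s = "avoiding_prefix S N Q n"
  assume S: "S m (?s div 2 ^ (n - m))"
  have nonneg: "c ^ r * ext_count S (Suc m) r u \<ge> 0" for m r u using c_pos by simp
  have "1 = c ^ 0 * ext_count S (Suc (m - 1)) 0 (?s div 2 ^ (n - Suc (m - 1)))"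
    using S assms by (simp add: ext_count_def)
  also have "\<dots> \<le> (\<Sum>r<Q * Suc n. c ^ r * ext_count S (Suc (m - 1)) r (?s div 2 ^ (n - Suc (m - 1))))"
    using assms nonneg by (intro member_le_sum[of 0 "{..<Q * Suc n}"
      "\<lambda>r. c ^ r * ext_count S (Suc (m - 1)) r (?s div 2 ^ (n - Suc (m - 1)))"])
      (auto simp: less_imp_le[OF c_pos])
  also have "\<dots> \<le> real_potential n ?s"
    unfolding real_potential_def using assms nonneg
    by (intro member_le_sum[of "m - 1" "{..<n}"
      "\<lambda>m. \<Sum>r<Q * Suc n. c ^ r * ext_count S (Suc m) r (?s div 2 ^ (n - Suc m))"] sum_nonneg) auto
  finally show False using avoiding_prefix_invariant[of n] by simp
qed

end

text \<open>Later steps only add powers \<open>2 ^ n\<close> with \<open>m \<le> n\<close>, so the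
  prefixes are coherent.\<close>

lemma avoiding_prefix_take_bit:
  "m \<le> n \<Longrightarrow> take_bit m (avoiding_prefix S N Q n) = take_bit m (avoiding_prefix S N Q m)"
proof (induction n rule: dec_induct)
  case (step n)
  have "take_bit m (t + 2 ^ n) = take_bit m t" for t :: nat
    using step.hyps by (simp add: take_bit_eq_mod mod_add_right_eq[symmetric] le_imp_power_dvd dvd_imp_mod_0 del: mod_add_right_eq)
  then show ?case using step.IH by (simp add: avoiding_prefix_def)
qed simp

theorem computable_avoiding_sequence:
  fixes lam :: real
  assumes S: "decidable_in A (\<lambda>x. S (pfst x) (psnd x))"
    and lam: "1 \<le> lam" "lam < 2"
    and sparse: "\<And>l. l \<ge> l1 \<Longrightarrow> card {w. w < 2 ^ l \<and> S l w} \<le> lam ^ l"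
  obtains B l0 where "decidable_in A B"
    and "\<And>i l. l \<ge> l0 \<Longrightarrow> \<not> S l (horner_sum of_bool 2 (map B [i..<i + l]))"
proof -
  \<comment> \<open>This makes \<open>1 / N\<close> smaller than \<open>1 - lam / 2\<close>, hence
    \<open>x < 1\<close>.\<close>
  obtain N' where N': "inverse (real (Suc N')) < (2 - lam) / 2"
    using reals_Archimedean[of "(2 - lam) / 2"] lam by auto
  define N where "N = Suc N'"
  define c x where "c = real (Suc N) / real (2 * N)" and "x = c * lam"
  have "x = lam / 2 + inverse N * (lam / 2)" by (simp add: x_def c_def N_def field_simps)
  also have "\<dots> \<le> lam / 2 + inverse N * 1"
    using lam by (intro add_left_mono mult_left_mono) auto
  also have "\<dots> < 1" using N' by (simp add: N_def)
  finally have x: "x < 1" .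
  have x0: "x > 0" using lam by (simp add: x_def c_def N_def)
  \<comment> \<open>Each summand of \<open>small\<close> gets half of the allowance
    \<open>1 / (2 * N)\<close>; the minimum with 1 also ensures
    \<open>4 * x ^ Q \<le> 1\<close>.\<close>
  define y where "y = min 1 ((1 - x) / (4 * N))"
  have y: "y > 0" using x by (simp add: y_def N_def)
  obtain l2 where l2: "x ^ l2 < y" using real_arch_pow_inv[OF y x] by blast
  obtain Q where "x ^ Q < y / 4" using real_arch_pow_inv[of "y / 4", OF _ x] y by auto
  then have Q: "4 * x ^ Q < y" by simp
  have "Q > 0" using Q by (cases Q) (auto simp: y_def)
  define l0 where "l0 = max 1 (max l1 l2)"
  have "x ^ l0 \<le> x ^ l2" using x x0 by (intro power_decreasing) (auto simp: l0_def)
  then have "x ^ l0 + 4 * x ^ Q \<le> (1 - x) / (4 * N) + (1 - x) / (4 * N)"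
    using l2 Q by (auto simp: y_def)
  also have "\<dots> = 1 / (2 * N) * (1 - x)" by simp
  finally have small: "x ^ l0 / (1 - x) + 4 * x ^ Q / (1 - x) \<le> 1 / (2 * N)"
    using x by (simp add: add_divide_distrib[symmetric] pos_divide_le_eq)
  \<comment> \<open>Short strings are released, since sparseness is only known for long
    ones.\<close>
  define S' where "S' l w \<longleftrightarrow> l0 \<le> l \<and> S l w" for l w
  define s where "s = avoiding_prefix S' N Q"
  define B where "B i = bit (s (Suc i)) i" for i
  have avoids: "\<not> S' m (s n div 2 ^ (n - m))" if "0 < m" "m \<le> n" for m n
    unfolding s_def
  proof (rule avoiding_prefix_avoids[of N lam l0 S' c x Q])
    show "real (card {w. w < 2 ^ l \<and> S' l w}) \<le> lam ^ l" if "l0 \<le> l" for l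
      using sparse[of l] that by (simp add: S'_def l0_def)
  qed (use lam x small Q that \<open>Q > 0\<close> in \<open>auto simp: N_def S'_def c_def x_def y_def\<close>)
  have s_less: "s n < 2 ^ n" for n
    by (induction n) (auto simp: s_def avoiding_prefix_def)
  have bit_s: "bit (s n) i \<longleftrightarrow> B i" if "i < n" for i n
    using avoiding_prefix_take_bit[of "Suc i" n S' N Q] that
    by (auto simp: B_def s_def bit_take_bit_iff dest!: arg_cong[where f = "\<lambda>a. bit a i"])
  have "decidable_in A (\<lambda>x. S' (pfst x) (psnd x))"
    unfolding S'_def by (intro computable S)
  then have "computable_in A s" unfolding s_def by (rule computable_avoiding_prefix)
  then have comp_s: "computable_in A (\<lambda>n. s (f n))" if "computable_in A f" for f
    using that by (rule computable_comp)
  have "decidable_in A (\<lambda>i. s (Suc i) div 2 ^ i mod 2 = 1)" by (intro computable comp_s)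
  then have "decidable_in A B" by (simp only: B_def[abs_def] bit_iff_odd odd_iff_mod_2_eq_one)
  moreover have "\<not> S l (horner_sum of_bool 2 (map B [i..<i + l]))" if "l \<ge> l0" for i l
  proof -
    have "s (i + l) div 2 ^ i < 2 ^ l"
      using s_less[of "i + l"] by (simp add: less_mult_imp_div_less power_add mult.commute)
    \<comment> \<open>Every factor of \<open>B\<close> is a suffix of some prefix
      \<open>s (i + l)\<close>; dividing by \<open>2 ^ i\<close> drops the first \<open>i\<close>
      bits.\<close>
    moreover have "map (bit (s (i + l) div 2 ^ i)) [0..<l] = map B [i..<i + l]"
      by (auto intro!: nth_equalityI simp: bit_s bit_drop_bit_eq simp flip: drop_bit_eq_div)
    ultimately have "horner_sum of_bool 2 (map B [i..<i + l]) = s (i + l) div 2 ^ i"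
      by (metis horner_sum_bit_eq_take_bit take_bit_nat_eq_self)
    then show ?thesis using avoids[of l "i + l"] that by (auto simp: S'_def l0_def)
  qed
  ultimately show thesis by (rule that)
qed

section \<open>Candidates for the output of a program\<close>

text \<open>\<open>list_encode\<close> puts the head outermost, so the code is built from the last
  bit to the first.\<close>

definition word_code :: "nat \<Rightarrow> nat \<Rightarrow> nat" where
  "word_code l w = rec_nat 0 (\<lambda>k c. Suc (prod_encode (w div 2 ^ (l - Suc k) mod 2, c))) l"

lemma computable_word_code [computable]:
  assumes "computable_in A f" "computable_in A g"
  shows "computable_in A (\<lambda>n. word_code (f n) (g n))"
  unfolding word_code_def
  by (intro computable computable_comp[OF assms(1)] computable_comp[OF assms(2)] assms)

text \<open>After \<open>k\<close> rounds the recursion holds the code of the last \<open>k\<close>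
  bits.\<close>

lemma word_code_horner_sum:
  "word_code (length \<sigma>) (horner_sum of_bool 2 \<sigma>) = string_code \<sigma>"
proof -
  let ?w = "horner_sum of_bool 2 \<sigma> :: nat"
  have "rec_nat 0 (\<lambda>k c. Suc (prod_encode (?w div 2 ^ (length \<sigma> - Suc k) mod 2, c))) k
      = string_code (drop (length \<sigma> - k) \<sigma>)" if "k \<le> length \<sigma>" for k
    using that
  proof (induction k)
    case (Suc k)
    let ?j = "length \<sigma> - Suc k"
    have "?w div 2 ^ ?j mod 2 = of_bool (bit ?w ?j)"
      by (simp add: bit_iff_odd mod2_eq_if)
    also have "bit ?w ?j \<longleftrightarrow> \<sigma> ! ?j"
      using Suc.prems by (auto simp: bit_horner_sum_bit_iff)
    finally have "?w div 2 ^ ?j mod 2 = of_bool (\<sigma> ! ?j)" .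
    moreover have "drop ?j \<sigma> = \<sigma> ! ?j # drop (length \<sigma> - k) \<sigma>"
      using Suc.prems Cons_nth_drop_Suc[of ?j \<sigma>] by (simp add: Suc_diff_Suc)
    ultimately show ?case using Suc by (simp add: string_code_def)
  qed (simp add: string_code_def)
  from this[of "length \<sigma>"] show ?thesis by (simp add: word_code_def)
qed

lemma string_code_eq_iff: "string_code \<sigma> = string_code \<tau> \<longleftrightarrow> \<sigma> = \<tau>"
  by (auto simp: string_code_def list_encode_eq inj_on_def dest!: map_injective)

lemma horner_sum_of_nat_bits:
  "w < 2 ^ l \<Longrightarrow> horner_sum of_bool 2 (map (bit w) [0..<l]) = (w :: nat)"
  by (simp add: horner_sum_bit_eq_take_bit take_bit_nat_eq_self)

lemma word_code_inject:
  assumes "w < 2 ^ l" "w' < 2 ^ l"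
  shows "word_code l w = word_code l w' \<longleftrightarrow> w = w'"
proof -
  have "word_code l u = string_code (map (bit u) [0..<l])" if "u < 2 ^ l" for u
    using word_code_horner_sum[of "map (bit u) [0..<l]"] that by (simp add: horner_sum_of_nat_bits)
  then have "word_code l w = word_code l w' \<longleftrightarrow> map (bit w) [0..<l] = map (bit w') [0..<l]"
    using assms by (simp only: string_code_eq_iff)
  also have "\<dots> \<longleftrightarrow> w = w'"
    by (metis horner_sum_of_nat_bits assms)
  finally show ?thesis .
qed

section \<open>Tuples of words and the bit length of questions\<close>

definition digit :: "nat \<Rightarrow> nat \<Rightarrow> nat \<Rightarrow> nat" where
  "digit l T i = T div 2 ^ (l * i) mod 2 ^ l"

lemma computable_digit [computable]:
  "computable_in A f \<Longrightarrow> computable_in A g \<Longrightarrow> computable_in A h \<Longrightarrow>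
    computable_in A (\<lambda>n. digit (f n) (g n) (h n))"
  unfolding digit_def by (intro computable)

lemma digit_less: "digit l T i < 2 ^ l"
  by (simp add: digit_def)

text \<open>Blocks of fixed width \<open>l\<close> keep a tuple within \<open>l * length ws\<close>
  bits; iterated pairing would double the length for each entry.\<close>

lemma digits_exist:
  assumes "\<forall>w\<in>set ws. w < 2 ^ l"
  obtains T where "T < 2 ^ (l * length ws)" "\<And>i. i < length ws \<Longrightarrow> digit l T i = ws ! i"
  using assms
proof (induction ws arbitrary: thesis)
  case Nil
  show ?case by (rule Nil(1)[of 0]) auto
next
  case (Cons w ws)
  from Cons.IH Cons.prems(2) obtain T where T: "T < 2 ^ (l * length ws)"
    "\<And>i. i < length ws \<Longrightarrow> digit l T i = ws ! i" by auto
  have w: "w < 2 ^ l" using Cons.prems(2) by simp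
  show ?case
  proof (rule Cons.prems(1))
    have "w + 2 ^ l * T < 2 ^ l * Suc T" using w by simp
    also have "\<dots> \<le> 2 ^ l * 2 ^ (l * length ws)" using T(1) by (intro mult_left_mono) auto
    finally show "w + 2 ^ l * T < 2 ^ (l * length (w # ws))" by (simp add: power_add)
  next
    fix i assume "i < length (w # ws)"
    moreover have "digit l (w + 2 ^ l * T) (Suc j) = digit l T j" for j
      using w by (simp add: digit_def power_add div_mult2_eq)
    ultimately show "digit l (w + 2 ^ l * T) i = (w # ws) ! i"
      using w T(2) by (cases i) (auto simp: digit_def)
  qed
qed

lemma prod_encode_less:
  assumes "x < 2 ^ j" "y < 2 ^ j"
  shows "prod_encode (x, y) < 2 ^ (2 * j + 2)"
proof -
  have "triangle n \<le> n * Suc n" for n by (simp add: triangle_def)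
  then have "prod_encode (x, y) \<le> (x + y) * Suc (x + y) + x"
    by (simp add: prod_encode_def)
  also have "\<dots> < Suc (x + y) * Suc (x + y)" by simp
  also have "\<dots> \<le> 2 ^ (j + 1) * 2 ^ (j + 1)" using assms by (intro mult_mono) auto
  also have "\<dots> = 2 ^ (2 * j + 2)" by (simp only: power_add[symmetric]) (simp add: mult_2)
  finally show ?thesis .
qed

definition question :: "nat \<Rightarrow> nat \<Rightarrow> nat \<Rightarrow> nat \<Rightarrow> nat" where
  "question l k v T = prod_encode (l, prod_encode (k, prod_encode (v, T)))"

text \<open>Each of the three pairings doubles the bit length and adds 2, starting from at most
  \<open>l * l ^ E\<close> bits.\<close>

lemma question_less:
  assumes "0 < l" "k \<le> l" "v < 2 ^ k" "T < 2 ^ (l * l ^ E)"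
  shows "question l k v T < 2 ^ (8 * l ^ (E + 1) + 14)"
proof -
  define M where "M = l * l ^ E"
  have "l \<le> M" using assms(1) by (simp add: M_def)
  then have pow: "(2::nat) ^ j \<le> 2 ^ M" if "j \<le> l" for j
    using that by (intro power_increasing) auto
  have l: "l < 2 ^ M" "k < 2 ^ M"
    using pow[of l] assms(2) less_exp[of l] by linarith+
  have v: "v < 2 ^ M" using less_le_trans[OF assms(3) pow[OF assms(2)]] .
  have lift: "a < 2 ^ i \<Longrightarrow> i \<le> j \<Longrightarrow> a < (2::nat) ^ j" for a i j
    using power_increasing[of i j "2::nat"] by linarith
  have 1: "prod_encode (v, T) < 2 ^ (2 * M + 2)"
    using v assms(4) by (intro prod_encode_less) (auto simp: M_def)
  have 2: "prod_encode (k, prod_encode (v, T)) < 2 ^ (2 * (2 * M + 2) + 2)"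
    by (rule prod_encode_less[OF lift[OF l(2)] 1]) simp
  have "question l k v T < 2 ^ (2 * (2 * (2 * M + 2) + 2) + 2)"
    unfolding question_def by (rule prod_encode_less[OF lift[OF l(1)] 2]) simp
  also have "2 * (2 * (2 * M + 2) + 2) + 2 = 8 * l ^ (E + 1) + 14" by (simp add: M_def)
  finally show ?thesis .
qed

text \<open>A number of at least 3 and at most \<open>2 ^ K\<close> has logarithm at most
  \<open>K\<close>. Arguments below \<open>a\<close> are sent to the value at \<open>a\<close>, so
  \<open>a\<close> needs the same bound.\<close>

lemma constant_below_log_le:
  assumes "\<epsilon> < 1" "a \<ge> 3" "y \<le> 2 ^ K" "a \<le> 2 ^ K"
  shows "constant_below a (\<lambda>n. (log 2 (real n)) powr (1 - \<epsilon>)) y \<le> real K powr (1 - \<epsilon>)"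
proof -
  have log: "log 2 (real (2 ^ K)) = K" by (simp add: log_nat_power)
  have "(log 2 (real n)) powr (1 - \<epsilon>) \<le> real K powr (1 - \<epsilon>)" if "3 \<le> n" "n \<le> 2 ^ K" for n
    using log_bound_mono[OF assms(1) that] by (simp only: log)
  then show ?thesis using assms by (simp add: constant_below_def)
qed

text \<open>
  The program given by the \<open>k\<close> low bits of \<open>v\<close> cannot output a string \<open>w\<close> of length \<open>l\<close> whose first
  position in a tuple \<open>T\<close> (of \<open>a\<close> digits to the base \<open>2 ^ l\<close>) is the answer \<open>x l k v T\<close>.
\<close>

definition candidate :: "(nat \<Rightarrow> nat \<Rightarrow> nat \<Rightarrow> nat \<Rightarrow> nat) \<Rightarrow> nat \<Rightarrow> nat \<Rightarrow> nat \<Rightarrow> nat \<Rightarrow> nat \<Rightarrow> bool" where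
  "candidate x a l k v w \<longleftrightarrow> w < 2 ^ l \<and>
    (\<forall>T<2 ^ (l * a). \<not> (digit l T (x l k v T) = w \<and> (\<forall>i<x l k v T. digit l T i \<noteq> w)))"

text \<open>If there were \<open>a\<close> candidates, some \<open>T\<close> would list
  \<open>a\<close> of them without repetition. The answer for this \<open>T\<close> would point to
  the first occurrence of a candidate, which it thereby rules out.\<close>

lemma card_candidate:
  assumes "\<And>T. T < 2 ^ (l * a) \<Longrightarrow> x l k v T < a"
  shows "card {w. candidate x a l k v w} < a"
proof (rule ccontr)
  let ?G = "{w. candidate x a l k v w}"
  have fin: "finite ?G" by (rule finite_subset[of _ "{..<2 ^ l}"]) (auto simp: candidate_def)
  assume "\<not> card ?G < a"
  then obtain H where H: "H \<subseteq> ?G" "card H = a" by (metis not_less obtain_subset_with_card_n)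
  have "finite H" using H fin finite_subset by blast
  then obtain ws where ws: "set ws = H" "distinct ws" using finite_distinct_list by blast
  have len: "length ws = a" using ws H distinct_card by fastforce
  have "\<forall>w\<in>set ws. w < 2 ^ l" using ws H by (auto simp: candidate_def)
  then obtain T where T: "T < 2 ^ (l * a)" "\<And>i. i < a \<Longrightarrow> digit l T i = ws ! i"
    using digits_exist len by metis
  have i: "x l k v T < a" using assms T(1) .
  then have "ws ! (x l k v T) \<in> set ws" using len by simp
  then have "ws ! (x l k v T) \<in> ?G" using ws(1) H(1) by blast
  moreover have "ws ! j \<noteq> ws ! (x l k v T)" if "j < x l k v T" for j
    using that i ws len by (simp add: nth_eq_iff_index_eq)
  ultimately show False using T i by (auto simp: candidate_def)
qed

text \<open>The threshold \<open>l - l div Q\<close> replaces \<open>\<delta> * l\<close> by a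
  natural number; it is large enough when \<open>1 / Q < 1 - \<delta>\<close>.\<close>

definition suspect :: "(nat \<Rightarrow> nat \<Rightarrow> nat \<Rightarrow> nat \<Rightarrow> nat) \<Rightarrow> nat \<Rightarrow> nat \<Rightarrow> nat \<Rightarrow> nat \<Rightarrow> bool" where
  "suspect x Q E l w \<longleftrightarrow> (\<exists>k<l - l div Q. \<exists>v<2 ^ k. candidate x (l ^ E) l k v w)"

text \<open>There are fewer than \<open>2 ^ D\<close> programs of length below \<open>D\<close>, and
  each has fewer than \<open>l ^ E\<close> candidates.\<close>

lemma card_suspect:
  assumes "\<And>k v T. k < l \<Longrightarrow> v < 2 ^ k \<Longrightarrow> T < 2 ^ (l * l ^ E) \<Longrightarrow> x l k v T < l ^ E"
  shows "card {w. suspect x Q E l w} \<le> 2 ^ (l - l div Q) * l ^ E"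
proof -
  let ?D = "l - l div Q"
  have "{w. suspect x Q E l w} = (\<Union>k<?D. \<Union>v<2 ^ k. {w. candidate x (l ^ E) l k v w})"
    by (auto simp: suspect_def)
  then have "card {w. suspect x Q E l w} \<le> (\<Sum>k<?D. card (\<Union>v<2 ^ k. {w. candidate x (l ^ E) l k v w}))"
    by (simp only: card_UN_le finite_lessThan)
  also have "\<dots> \<le> (\<Sum>k<?D. \<Sum>v<2 ^ k. card {w. candidate x (l ^ E) l k v w})"
    by (rule sum_mono, rule card_UN_le) simp
  also have "\<dots> \<le> (\<Sum>k<?D. \<Sum>v<(2::nat) ^ k. l ^ E)"
  proof (rule sum_mono, rule sum_mono, rule less_imp_le, rule card_candidate)
    fix k v T :: nat assume "k \<in> {..<?D}" "v \<in> {..<2 ^ k}" "T < 2 ^ (l * l ^ E)"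
    then show "x l k v T < l ^ E" by (intro assms) auto
  qed
  also have "\<dots> = (\<Sum>k<?D. 2 ^ k) * l ^ E" by (simp add: sum_distrib_right)
  also have "(\<Sum>k<?D. 2 ^ k) \<le> (2::nat) ^ ?D"
    using mask_eq_sum_exp_nat[of ?D] by (simp add: lessThan_def)
  finally show ?thesis by simp
qed

lemma exponential_growth_bound:
  assumes "Q > 0"
  obtains lam :: real and l1 where "1 \<le> lam" "lam < 2"
    and "\<And>l. l \<ge> l1 \<Longrightarrow> real (2 ^ (l - l div Q) * l ^ E) \<le> lam ^ l"
proof -
  \<comment> \<open>The saving \<open>1 / Q = 2 * q\<close> in the exponent is split: one
    \<open>q\<close> makes \<open>lam = 2 powr (1 - q)\<close> smaller than 2, the other beats the
    polynomial factor.\<close>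
  define q where "q = 1 / (2 * real Q)"
  have q: "0 < q" "q \<le> 1 / 2" using assms by (auto simp: q_def field_simps)
  let ?lam = "2 powr (1 - q)"
  have lam_ge: "1 \<le> ?lam" using q by (simp add: ge_one_powr_ge_zero)
  have "?lam < 2 powr 1" using q by (intro powr_less_mono) auto
  then have lam_less: "?lam < 2" by simp
  define b where "b = q * ln 2"
  have b: "b > 0" using q by (simp add: b_def)
  have "filterlim (\<lambda>l. b * real l) at_top sequentially"
    using b by (intro filterlim_tendsto_pos_mult_at_top[OF tendsto_const] filterlim_real_sequentially)
  from filterlim_compose[OF tendsto_power_div_exp_0 this]
  have "(\<lambda>l. 2 / b ^ E * ((b * real l) ^ E / exp (b * real l))) \<longlonglongrightarrow> 2 / b ^ E * 0"
    by (rule tendsto_mult_left)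
  moreover have "2 / b ^ E * ((b * real l) ^ E / exp (b * real l)) = 2 * real l ^ E / (2 powr q) ^ l" for l
  proof -
    have "exp (b * real l) = (2 powr q) ^ l"
      by (simp add: powr_def b_def mult.commute flip: exp_of_nat_mult)
    then show ?thesis using b by (simp add: power_mult_distrib)
  qed
  ultimately have "(\<lambda>l. 2 * real l ^ E / (2 powr q) ^ l) \<longlonglongrightarrow> 0" by simp
  then have "eventually (\<lambda>l. 2 * real l ^ E / (2 powr q) ^ l < 1) sequentially"
    by (rule order_tendstoD) simp
  then obtain l1 where l1: "\<And>l. l \<ge> l1 \<Longrightarrow> 2 * real l ^ E / (2 powr q) ^ l < 1"
    by (auto simp: eventually_sequentially)
  have "real (2 ^ (l - l div Q) * l ^ E) \<le> ?lam ^ l" if "l \<ge> l1" for l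
  proof -
    \<comment> \<open>Rounding in \<open>l div Q\<close> loses less than 1 in the exponent, whence
      the factor 2 in the limit above.\<close>
    have "l < Q * Suc (l div Q)" using assms by (metis dividend_less_times_div mult_Suc_right add.commute)
    then have "real l < real Q * (real (l div Q) + 1)"
      by (metis of_nat_Suc of_nat_less_iff of_nat_mult add.commute)
    then have "real l / Q < l div Q + 1" using assms by (simp add: field_simps)
    then have "real (l - l div Q) \<le> l * (1 - 2 * q) + 1"
      by (simp add: of_nat_diff q_def algebra_simps)
    then have "2 powr (l - l div Q) \<le> 2 powr (l * (1 - 2 * q) + 1)" by simp
    also have "l * (1 - 2 * q) + 1 = 1 + l * (1 - q) - l * q" by (simp add: algebra_simps)
    also have "2 powr \<dots> = 2 * ?lam ^ l / (2 powr q) ^ l"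
    proof -
      have "(2 powr u) ^ l = 2 powr (l * u)" for u :: real by (simp add: powr_power)
      then show ?thesis
        by (simp only: powr_diff[of 2 "1 + l * (1 - q)" "l * q"] powr_add[of 2 1 "l * (1 - q)"]) simp
    qed
    finally have "2 ^ (l - l div Q) \<le> 2 * ?lam ^ l / (2 powr q) ^ l"
      by (simp only: powr_realpow[OF zero_less_numeral])
    then have "2 ^ (l - l div Q) * real l ^ E \<le> 2 * ?lam ^ l / (2 powr q) ^ l * real l ^ E"
      by (intro mult_right_mono) auto
    also have "\<dots> = ?lam ^ l * (2 * real l ^ E / (2 powr q) ^ l)" by simp
    also have "\<dots> \<le> ?lam ^ l * 1" using l1[OF that] by (intro mult_left_mono) auto
    finally show ?thesis by simp
  qed
  then show thesis using that lam_ge lam_less by blast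
qed

section \<open>Attained complexity and the search for an output in a tuple\<close>

lemma partrec_mu_search:
  assumes "computable_in A (\<lambda>m. h (pfst m) (psnd m))"
  shows "partrec_in A (\<lambda>a. mu_search (\<lambda>k. Some (h a k)))"
  using partrec_in.mu[OF assms[unfolded computable_in_def]] by simp

lemma mu_search_total:
  "mu_search (\<lambda>k. Some (g k)) = (if \<exists>k. g k = 0 then Some (LEAST k. g k = 0) else None)"
  by (auto simp: mu_search_def)

text \<open>The universal machine simulates this machine, so every string has a program and the
  \<open>LEAST\<close> in \<open>prefix_complexity\<close> is attained.\<close>

lemma prefix_free_machine_constant: "prefix_free_machine [[] \<mapsto> \<sigma>]"
proof -
  let ?f = "\<lambda>n. mu_search (\<lambda>k. Some (of_bool (\<not> (n = 0 \<and> k = string_code \<sigma>))))"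
  have "partrec ?f" by (intro partrec_mu_search computable)
  moreover have "?f (string_code \<tau>) = map_option string_code ([[] \<mapsto> \<sigma>] \<tau>)" for \<tau>
    using string_code_eq_iff[of \<tau> "[]"] by (auto simp: mu_search_total string_code_def intro: Least_equality)
  ultimately show ?thesis
    unfolding prefix_free_machine_def partrec_strings_def by auto
qed

lemma prefix_complexity_attained:
  assumes "universal_machine U"
  obtains \<tau> where "U \<tau> = Some \<sigma>" "length \<tau> = prefix_complexity U \<sigma>"
proof -
  obtain \<rho> where "\<And>\<tau>. U (\<rho> @ \<tau>) = [[] \<mapsto> \<sigma>] \<tau>"
    using assms prefix_free_machine_constant[of \<sigma>] unfolding universal_machine_def by metis
  from this[of "[]"] have "U \<rho> = Some \<sigma>" by simp
  then have "\<exists>n \<tau>. U \<tau> = Some \<sigma> \<and> length \<tau> = n" by auto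
  then have "\<exists>\<tau>. U \<tau> = Some \<sigma> \<and> length \<tau> = prefix_complexity U \<sigma>"
    unfolding prefix_complexity_def by (rule LeastI_ex)
  then show thesis using that by blast
qed

text \<open>This is the function to which linear universality is applied. It diverges if the program
  has no output or the output is not a digit of \<open>T\<close>.\<close>

definition position_search :: "(nat \<rightharpoonup> nat) \<Rightarrow> nat \<rightharpoonup> nat" where
  "position_search f n =
    (let l = pfst n; k = pfst (psnd n); v = pfst (psnd (psnd n)); T = psnd (psnd (psnd n)) in
      Option.bind (f (word_code k v)) (\<lambda>y. mu_search (\<lambda>i. Some (of_bool (word_code l (digit l T i) \<noteq> y)))))"

lemma partrec_position_search:
  assumes "partrec f"
  shows "partrec (position_search f)"
proof -
  have "computable_in {} (\<lambda>n. word_code (pfst (psnd n)) (pfst (psnd (psnd n))))"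
    by (intro computable)
  from partrec_in.comp[OF assms this[unfolded computable_in_def]]
  have "partrec (\<lambda>n. f (word_code (pfst (psnd n)) (pfst (psnd (psnd n)))))" by simp
  from partrec_in.pair[OF this computable_id[unfolded computable_in_def]]
  \<comment> \<open>The output is kept together with the question, because the search needs
    both.\<close>
  have 1: "partrec (\<lambda>n. Option.bind (f (word_code (pfst (psnd n)) (pfst (psnd (psnd n)))))
      (\<lambda>y. Some (prod_encode (y, n))))" by simp
  have "partrec (\<lambda>m. mu_search (\<lambda>i. Some (of_bool
      (word_code (pfst (psnd m)) (digit (pfst (psnd m)) (psnd (psnd (psnd (psnd m)))) i) \<noteq> pfst m))))"
    by (intro partrec_mu_search computable)
  from partrec_in.comp[OF this 1] show ?thesis
    by (simp add: position_search_def[abs_def] Let_def)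
qed

text \<open>If some answer pointed to the first occurrence of the true output, it would equal the
  value of \<open>position_search\<close>, hence of \<open>\<psi>\<close>, against avoidance. So the
  output stays a candidate for its own program.\<close>

lemma compressible_imp_suspect:
  assumes f: "\<And>\<sigma>. f (string_code \<sigma>) = map_option string_code (U \<sigma>)"
    and \<psi>: "\<And>n. \<psi> (a * n + b) = position_search f n"
    and X: "\<And>n. \<psi> n \<noteq> Some (X n)"
    and \<tau>: "U \<tau> = Some \<sigma>" "length \<tau> < length \<sigma> - length \<sigma> div Q"
  shows "suspect (\<lambda>l k v T. X (a * question l k v T + b)) Q E (length \<sigma>) (horner_sum of_bool 2 \<sigma>)"
proof -
  let ?l = "length \<sigma>" and ?k = "length \<tau>"
  define v w where "v = (horner_sum of_bool 2 \<tau> :: nat)" and "w = (horner_sum of_bool 2 \<sigma> :: nat)"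
  have less: "v < 2 ^ ?k" "w < 2 ^ ?l"
    by (simp_all add: v_def w_def horner_sum_of_bool_2_less)
  have "\<not> (digit ?l T i = w \<and> (\<forall>j<i. digit ?l T j \<noteq> w))"
    if i: "i = X (a * question ?l ?k v T + b)" for T i
  proof
    assume *: "digit ?l T i = w \<and> (\<forall>j<i. digit ?l T j \<noteq> w)"
    have eq: "word_code ?l (digit ?l T j) = string_code \<sigma> \<longleftrightarrow> digit ?l T j = w" for j
      using word_code_inject[OF digit_less less(2)] word_code_horner_sum[of \<sigma>] by (simp add: w_def)
    have "f (word_code ?k v) = Some (string_code \<sigma>)"
      using f[of \<tau>] \<tau>(1) by (simp add: v_def word_code_horner_sum)
    then have "position_search f (question ?l ?k v T) =
        mu_search (\<lambda>j. Some (of_bool (digit ?l T j \<noteq> w)))"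
      by (simp add: position_search_def question_def eq)
    also have "\<dots> = Some i"
    proof -
      have "(LEAST j. digit ?l T j = w) = i"
        using * by (intro Least_equality) (auto simp flip: not_less)
      then show ?thesis using * by (auto simp: mu_search_total)
    qed
    finally show False using X \<psi> i by metis
  qed
  then show ?thesis
    unfolding suspect_def candidate_def w_def[symmetric] using less \<tau>(2) by blast
qed

text \<open>The base is at most \<open>l ^ (E + 2)\<close>, and
  \<open>(E + 2) * (1 - \<epsilon>) \<le> E\<close> follows from
  \<open>2 \<le> \<epsilon> * E\<close>.\<close>

lemma polynomial_growth_bound:
  assumes "0 < \<epsilon>" "\<epsilon> < 1" "2 / \<epsilon> \<le> real E" "C + 8 \<le> l"
  shows "real (8 * l ^ (E + 1) + C) powr (1 - \<epsilon>) \<le> real (l ^ E)"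
proof -
  have l: "l \<ge> 1" using assms by simp
  have "8 * l ^ (E + 1) + C \<le> 8 * l ^ (E + 1) + C * l ^ (E + 1)" using l by simp
  also have "\<dots> = (C + 8) * l ^ (E + 1)" by (simp add: algebra_simps)
  also have "\<dots> \<le> l * l ^ (E + 1)" using assms(4) by (intro mult_right_mono) auto
  also have "\<dots> = l ^ (E + 2)" by simp
  finally have "real (8 * l ^ (E + 1) + C) \<le> real (l ^ (E + 2))" by (simp only: of_nat_le_iff)
  then have "real (8 * l ^ (E + 1) + C) powr (1 - \<epsilon>) \<le> real (l ^ (E + 2)) powr (1 - \<epsilon>)"
    using assms by (intro powr_mono2) auto
  also have "\<dots> = real l powr (real (E + 2) * (1 - \<epsilon>))"
    using l by (simp add: powr_powr flip: powr_realpow del: power_Suc)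
  also have "\<dots> \<le> real l powr real E"
  proof (rule powr_mono)
    have "2 \<le> \<epsilon> * real E" using assms by (simp add: field_simps)
    then show "real (E + 2) * (1 - \<epsilon>) \<le> real E" using assms by (simp add: algebra_simps)
  qed (use l in simp)
  also have "\<dots> = real (l ^ E)" using l by (simp add: powr_realpow)
  finally show ?thesis .
qed

section \<open>The reduction\<close>

theorem mainTheorem4:
  fixes U :: "bool list \<rightharpoonup> bool list" and \<epsilon> \<delta> :: real and a :: nat
  assumes "universal_machine U"
    and "\<epsilon> \<in> \<rat>" and "0 < \<epsilon>" and "\<epsilon> < 1"
    and "\<delta> \<in> \<rat>" and "0 < \<delta>" and "\<delta> < 1"
    and "a \<ge> 3"
  shows "SC U \<delta> \<le>\<^sub>w LUA (constant_below a (\<lambda>n. (log 2 (real n)) powr (1 - \<epsilon>)))"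
  unfolding weakly_reducible_def
proof
  let ?p = "constant_below a (\<lambda>n. (log 2 (real n)) powr (1 - \<epsilon>))"
  fix X assume "X \<in> LUA ?p"
  then obtain \<psi> where X_less: "\<And>n. real (X n) < ?p n" and "linearly_universal \<psi>"
    and "\<not> (\<exists>n\<in>dom \<psi>. \<psi> n = Some (X n))"
    unfolding LUA_def by blast
  then have avoid: "\<psi> n \<noteq> Some (X n)" for n by blast
  obtain f where "partrec f" and f: "\<And>\<sigma>. f (string_code \<sigma>) = map_option string_code (U \<sigma>)"
    using assms(1) unfolding universal_machine_def prefix_free_machine_def partrec_strings_def by blast
  then obtain c d where \<psi>: "\<And>n. \<psi> (c * n + d) = position_search f n"
    using \<open>linearly_universal \<psi>\<close> partrec_position_search unfolding linearly_universal_def by metis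
  obtain Q :: nat where Q: "inverse (real (Suc Q)) < 1 - \<delta>"
    using reals_Archimedean[of "1 - \<delta>"] assms by auto
  obtain E :: nat where E: "2 / \<epsilon> \<le> real E" using real_arch_simple by blast
  define x where "x l k v T = X (c * question l k v T + d)" for l k v T
  define S where "S = suspect x (Suc Q) E"
  obtain lam l1 where lam: "1 \<le> lam" "lam < 2"
    and l1: "\<And>l. l \<ge> l1 \<Longrightarrow> real (2 ^ (l - l div Suc Q) * l ^ E) \<le> lam ^ l"
    using exponential_growth_bound[of "Suc Q"] by blast
  \<comment> \<open>Besides the 14 bits of \<open>question_less\<close>, \<open>C\<close> covers the
    linear map with coefficients \<open>c\<close>, \<open>d\<close> and the cutoff \<open>a\<close>
    of the bound.\<close>
  define C where "C = 14 + (c + d + a)"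
  have x_less: "x l k v T < l ^ E"
    if "C + 8 \<le> l" "k < l" "v < 2 ^ k" "T < 2 ^ (l * l ^ E)" for l k v T
  proof -
    let ?K = "8 * l ^ (E + 1) + C"
    let ?q = "question l k v T"
    have q: "?q < 2 ^ (8 * l ^ (E + 1) + 14)"
      using that by (intro question_less) auto
    have "c * ?q + d \<le> (c + d + a) * (?q + 1)" by (simp add: algebra_simps)
    also have "\<dots> \<le> 2 ^ (c + d + a) * 2 ^ (8 * l ^ (E + 1) + 14)"
      using q less_exp[of "c + d + a"] by (intro mult_mono) auto
    also have "\<dots> = 2 ^ ?K" by (simp only: power_add[symmetric] C_def) (simp only: ac_simps)
    finally have "c * ?q + d \<le> 2 ^ ?K" .
    moreover have "a \<le> 2 ^ ?K"
      by (rule order.trans[OF less_imp_le[OF less_exp]], rule power_increasing) (simp_all add: C_def)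
    ultimately have "?p (c * ?q + d) \<le> real ?K powr (1 - \<epsilon>)"
      using assms by (intro constant_below_log_le)
    also have "\<dots> \<le> real (l ^ E)"
      using assms E that by (intro polynomial_growth_bound)
    finally have "real (X (c * ?q + d)) < real (l ^ E)"
      using X_less less_le_trans by blast
    then show ?thesis by (simp only: of_nat_less_iff x_def)
  qed
  have sparse: "real (card {w. w < 2 ^ l \<and> S l w}) \<le> lam ^ l" if "max l1 (C + 8) \<le> l" for l
  proof -
    have "{w. w < 2 ^ l \<and> S l w} = {w. S l w}" by (auto simp: S_def suspect_def candidate_def)
    then have "card {w. w < 2 ^ l \<and> S l w} \<le> 2 ^ (l - l div Suc Q) * l ^ E"
      unfolding S_def using that by (simp only:) (intro card_suspect x_less; simp)
    then have "real (card {w. w < 2 ^ l \<and> S l w}) \<le> real (2 ^ (l - l div Suc Q) * l ^ E)"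
      by (simp only: of_nat_le_iff)
    then show ?thesis using l1[of l] that by simp
  qed
  \<comment> \<open>All quantifiers over programs, tuples and positions are bounded, and
    \<open>X\<close> is queried for the answers.\<close>
  have "decidable_in {X} (\<lambda>n. S (pfst n) (psnd n))"
    unfolding S_def suspect_def candidate_def x_def question_def
    by (intro computable computable_query[of X]) simp_all
  then obtain B l0 where B: "decidable_in {X} B"
    and avoids: "\<And>i l. l \<ge> l0 \<Longrightarrow> \<not> S l (horner_sum of_bool 2 (map B [i..<i + l]))"
    using computable_avoiding_sequence[OF _ lam sparse] by blast
  \<comment> \<open>The additive constant \<open>l0\<close> makes the claim trivial for factors
    shorter than \<open>l0\<close>.\<close>
  have "\<delta> * real (length \<sigma>) - real l0 \<le> real (prefix_complexity U \<sigma>)"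
    if \<sigma>: "\<sigma> = map B [i..<j]" for i j \<sigma>
  proof (rule ccontr)
    assume "\<not> ?thesis"
    moreover have "\<delta> * real (length \<sigma>) \<le> real (length \<sigma>)"
      using assms by (simp add: mult_left_le_one_le)
    ultimately have K: "real (prefix_complexity U \<sigma>) < \<delta> * real (length \<sigma>)" and len: "l0 \<le> length \<sigma>"
      by linarith+
    obtain \<tau> where \<tau>: "U \<tau> = Some \<sigma>" "length \<tau> = prefix_complexity U \<sigma>"
      using prefix_complexity_attained[OF assms(1)] .
    have "real (length \<sigma> div Suc Q) \<le> real (length \<sigma>) * inverse (real (Suc Q))"
      using of_nat_div_le_of_nat[of "length \<sigma>" "Suc Q", where ?'a = real] by (simp add: divide_inverse)
    also have "\<dots> \<le> real (length \<sigma>) * (1 - \<delta>)"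
      using Q by (intro mult_left_mono) auto
    finally have "length \<tau> < length \<sigma> - length \<sigma> div Suc Q"
      using K \<tau>(2) by (simp add: algebra_simps)
    then have "S (length \<sigma>) (horner_sum of_bool 2 \<sigma>)"
      unfolding S_def x_def by (intro compressible_imp_suspect[OF f \<psi> avoid \<tau>(1)])
    moreover have "\<sigma> = map B [i..<i + length \<sigma>]" using \<sigma> by (cases "i \<le> j") auto
    ultimately show False using avoids[OF len, of i] by simp
  qed
  then have "(\<lambda>n. of_bool (B n)) \<in> SC U \<delta>" unfolding SC_def Let_def by blast
  moreover have "turing_computes X (\<lambda>n. of_bool (B n))"
    using B by (simp add: turing_computes_def computable_in_def)
  ultimately show "\<exists>Y\<in>SC U \<delta>. turing_computes X Y" by blast
qed

end
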